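(* Let $G$ be a finitely generated hyperbolic group, generated by elements $a_1,\ldots,a_n$. Then $G$, with the symmetric generating set $S=\{a_1,a_1^{-1},\ldots,a_n,a_n^{-1}\}$ linearly ordered by $a_1\leq a_1^{-1}\leq\ldots\leq a_n\leq a_n^{-1}$, is shortlex combable.
   Context: Let $G$ be a finitely generated group and $S\subseteq G$ a finite symmetric generating set ($s\in S$ implies $s^{-1}\in S$). The word metric is $d_S(g,g)=0$ and, for $g\neq h$, $d_S(g,h)=\min\{n\in\mathbb{N}: \exists s_1,\ldots,s_n\in S\ (g=hs_1\cdots s_n)\}$. A geodesic segment between $x,y\in G$ is a sequence $g_0=x,\ldots,g_n=y$ with $n=d_S(x,y)$ and $d_S(g_i,g_{i+1})=1$ for $i<n$. $G$ is hyperbolic (in the sense of Rips) if there is a constant $K\geq 0$ such that for any triple of points of $G$ and any geodesic segments $S_1,S_2,S_3$ connecting each pair of the triple, every point of each $S_i$ is at distance at most $K$ from the union of the other two segments. Fix a linear order on $S$. Let $W$ be the set of all reduced words over the alphabet $S$, i.e. finite strings $s_1s_2\ldots s_n$ of elements of $S$ such that for no $i<n$ the letters $s_i$ and $s_{i+1}$ are inverses of each other as group elements. For $w\in W$, $|w|$ is the length of $w$, $w_G\in G$ is the group element obtained by evaluating $w$ in $G$, and $w(\leq i)$ is the word consisting of the first $i$ letters of $w$. Let $\preceq'$ be the lexicographical order on $W$ induced by the linear order on $S$. The shortlex order $\preceq$ on $W$ is: $w\preceq v$ if either $|w|<|v|$, or $|w|=|v|$ and $w\preceq' v$. For $g\in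 G$, let $w_g$ be the $\preceq$-minimal element of $\{w\in W: w_G=g\}$ (one has $|w_g|=d_S(g,1_G)$). $G$ is called shortlex combable, with respect to $S$ and the fixed linear order on $S$, if there exists a constant $K\geq 1$ such that for every $g,h\in G$ with $d_S(g,h)=1$ and every $i\leq \min\{d_S(g,1_G),d_S(h,1_G)\}$ we have $d_S\big((w_g(\leq i))_G,(w_h(\leq i))_G\big)\leq K$. *)

theory Defs
  imports Complex_Main "HOL-Algebra.Generated_Groups"
begin

definition symmetric_generating_set :: "('a, 'b) monoid_scheme \<Rightarrow> 'a set \<Rightarrow> bool" where
  "symmetric_generating_set G S \<longleftrightarrow>
     finite S \<and> S \<subseteq> carrier G \<and> (\<forall>s\<in>S. inv\<^bsub>G\<^esub> s \<in> S) \<and> generate G S = carrier G"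

definition word_eval :: "('a, 'b) monoid_scheme \<Rightarrow> 'a list \<Rightarrow> 'a" where
  "word_eval G w = foldr (\<lambda>s g. s \<otimes>\<^bsub>G\<^esub> g) w \<one>\<^bsub>G\<^esub>"

definition word_dist :: "('a, 'b) monoid_scheme \<Rightarrow> 'a set \<Rightarrow> 'a \<Rightarrow> 'a \<Rightarrow> nat" where
  "word_dist G S g h =
     (if g = h then 0
      else (LEAST n. \<exists>w. length w = n \<and> set w \<subseteq> S \<and> g = h \<otimes>\<^bsub>G\<^esub> word_eval G w))"

definition geodesic_segment ::
    "('a, 'b) monoid_scheme \<Rightarrow> 'a set \<Rightarrow> 'a \<Rightarrow> 'a \<Rightarrow> 'a list \<Rightarrow> bool" where
  "geodesic_segment G S x y p \<longleftrightarrow>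
     set p \<subseteq> carrier G \<and> length p = word_dist G S x y + 1 \<and>
     p ! 0 = x \<and> p ! word_dist G S x y = y \<and>
     (\<forall>i < word_dist G S x y. word_dist G S (p ! i) (p ! (i + 1)) = 1)"

(* As A is nonempty and distances are natural numbers, "distance from p to A at most K"
   means that some point of A is within K of p. *)
definition within_dist :: "('a, 'b) monoid_scheme \<Rightarrow> 'a set \<Rightarrow> real \<Rightarrow> 'a \<Rightarrow> 'a set \<Rightarrow> bool" where
  "within_dist G S K p A \<longleftrightarrow> (\<exists>q\<in>A. real (word_dist G S p q) \<le> K)"

definition rips_hyperbolic_wrt :: "('a, 'b) monoid_scheme \<Rightarrow> 'a set \<Rightarrow> bool" where
  "rips_hyperbolic_wrt G S \<longleftrightarrow>
     (\<exists>K\<ge>0. \<forall>x\<in>carrier G. \<forall>y\<in>carrier G. \<forall>z\<in>carrier G. \<forall>p1 p2 p3.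
        geodesic_segment G S x y p1 \<and> geodesic_segment G S y z p2 \<and> geodesic_segment G S x z p3 \<longrightarrow>
          (\<forall>p\<in>set p1. within_dist G S K p (set p2 \<union> set p3)) \<and>
          (\<forall>p\<in>set p2. within_dist G S K p (set p1 \<union> set p3)) \<and>
          (\<forall>p\<in>set p3. within_dist G S K p (set p1 \<union> set p2)))"

(* Hyperbolicity is a property of the group alone: the generating set witnessing it need not
   be the one with respect to which combability is asserted. *)
definition hyperbolic_group :: "('a, 'b) monoid_scheme \<Rightarrow> bool" where
  "hyperbolic_group G \<longleftrightarrow>
     (\<exists>S. symmetric_generating_set G S \<and> rips_hyperbolic_wrt G S)"

definition reduced_words :: "('a, 'b) monoid_scheme \<Rightarrow> 'a set \<Rightarrow> 'a list set" where
  "reduced_words G S =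
     {w. set w \<subseteq> S \<and> (\<forall>i. i + 1 < length w \<longrightarrow> w ! (i + 1) \<noteq> inv\<^bsub>G\<^esub> (w ! i))}"

(* Linear orders are reflexive relations, as in linear_order_on; lexord expects the strict part. *)
definition lex_le :: "('a \<times> 'a) set \<Rightarrow> 'a list \<Rightarrow> 'a list \<Rightarrow> bool" where
  "lex_le r w v \<longleftrightarrow> w = v \<or> (w, v) \<in> lexord (r - Id)"

definition shortlex_le :: "('a \<times> 'a) set \<Rightarrow> 'a list \<Rightarrow> 'a list \<Rightarrow> bool" where
  "shortlex_le r w v \<longleftrightarrow> length w < length v \<or> length w = length v \<and> lex_le r w v"

definition shortlex_word ::
    "('a, 'b) monoid_scheme \<Rightarrow> 'a set \<Rightarrow> ('a \<times> 'a) set \<Rightarrow> 'a \<Rightarrow> 'a list" where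
  "shortlex_word G S r g =
     (THE w. w \<in> reduced_words G S \<and> word_eval G w = g \<and>
        (\<forall>v \<in> reduced_words G S. word_eval G v = g \<longrightarrow> shortlex_le r w v))"

definition shortlex_combable :: "('a, 'b) monoid_scheme \<Rightarrow> 'a set \<Rightarrow> ('a \<times> 'a) set \<Rightarrow> bool" where
  "shortlex_combable G S r \<longleftrightarrow>
     (\<exists>K::real. K \<ge> 1 \<and>
        (\<forall>g\<in>carrier G. \<forall>h\<in>carrier G. word_dist G S g h = 1 \<longrightarrow>
          (\<forall>i \<le> min (word_dist G S g \<one>\<^bsub>G\<^esub>) (word_dist G S h \<one>\<^bsub>G\<^esub>).
             real (word_dist G S (word_eval G (take i (shortlex_word G S r g)))
                                 (word_eval G (take i (shortlex_word G S r h)))) \<le> K)))"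

definition with_inverses :: "('a, 'b) monoid_scheme \<Rightarrow> 'a list \<Rightarrow> 'a list" where
  "with_inverses G as = concat (map (\<lambda>a. [a, inv\<^bsub>G\<^esub> a]) as)"

(* The enumeration may repeat elements (involutions, repeated or mutually inverse generators),
   so elements are compared by their first occurrence.  Whenever the chain
   x1 \<le> x2 \<le> ... does determine a linear order, this is that order: see listing_order_unique. *)
definition first_occurrence :: "'a list \<Rightarrow> 'a \<Rightarrow> nat" where
  "first_occurrence xs x = (LEAST i. i < length xs \<and> xs ! i = x)"

definition listing_order :: "'a list \<Rightarrow> ('a \<times> 'a) set" where
  "listing_order xs =
     {(x, y). x \<in> set xs \<and> y \<in> set xs \<and> first_occurrence xs x \<le> first_occurrence xs y}"

lemma first_occurrence:
  assumes "x \<in> set xs"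
  shows "first_occurrence xs x < length xs" "xs ! first_occurrence xs x = x"
proof -
  from assms obtain i where "i < length xs \<and> xs ! i = x" by (auto simp: in_set_conv_nth)
  then have "first_occurrence xs x < length xs \<and> xs ! first_occurrence xs x = x"
    unfolding first_occurrence_def by (rule LeastI)
  then show "first_occurrence xs x < length xs" "xs ! first_occurrence xs x = x" by auto
qed

lemma linear_order_listing_order: "linear_order_on (set xs) (listing_order xs)"
proof -
  have "antisym (listing_order xs)"
  proof (rule antisymI)
    fix x y assume "(x, y) \<in> listing_order xs" "(y, x) \<in> listing_order xs"
    then have "x \<in> set xs" "y \<in> set xs" "first_occurrence xs x = first_occurrence xs y"
      by (simp_all add: listing_order_def)
    then show "x = y" using first_occurrence(2) by metis
  qed
  moreover have "trans (listing_order xs)"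
    by (rule transI) (simp add: listing_order_def)
  moreover have "refl_on (set xs) (listing_order xs)" "listing_order xs \<subseteq> set xs \<times> set xs"
    by (auto simp: listing_order_def refl_on_def)
  moreover have "total_on (set xs) (listing_order xs)"
    by (auto simp: listing_order_def total_on_def)
  ultimately show ?thesis
    by (simp add: linear_order_on_def partial_order_on_def preorder_on_def)
qed

lemma listing_order_unique:
  assumes lin: "linear_order_on (set xs) r"
    and chain: "\<And>i. i + 1 < length xs \<Longrightarrow> (xs ! i, xs ! (i + 1)) \<in> r"
  shows "r = listing_order xs"
proof -
  have rfl: "\<And>x. x \<in> set xs \<Longrightarrow> (x, x) \<in> r" and tr: "trans r" and as: "antisym r"
    and sub: "r \<subseteq> set xs \<times> set xs"
    using lin by (auto simp: linear_order_on_def partial_order_on_def preorder_on_def refl_on_def)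
  have mon: "(xs ! i, xs ! j) \<in> r" if "i \<le> j" "j < length xs" for i j
    using that
  proof (induction j rule: dec_induct)
    case base
    then show ?case using rfl by simp
  next
    case (step j)
    then have "(xs ! i, xs ! j) \<in> r" "(xs ! j, xs ! Suc j) \<in> r" using chain[of j] by auto
    then show ?case using tr by (meson transD)
  qed
  have le: "(x, y) \<in> r" if "x \<in> set xs" "y \<in> set xs"
    "first_occurrence xs x \<le> first_occurrence xs y" for x y
    using mon[OF that(3)] first_occurrence that by metis
  show ?thesis
  proof
    show "listing_order xs \<subseteq> r" using le by (auto simp: listing_order_def)
    show "r \<subseteq> listing_order xs"
    proof (rule subrelI)
      fix x y assume xy: "(x, y) \<in> r"
      then have "x \<in> set xs" "y \<in> set xs" using sub by auto
      then show "(x, y) \<in> listing_order xs"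
        using le[of y x] xy antisymD[OF as, of x y]
        by (cases "first_occurrence xs x \<le> first_occurrence xs y") (auto simp: listing_order_def)
    qed
  qed
qed

end

(* A geodesic word over S is a quasi-geodesic for the word metric of any other finite generating
   set T; choose T hyperbolic. By the Morse lemma, two quasi-geodesics with the same endpoints stay
   close to each other: a point at maximal distance D from a quasi-geodesic p can be bypassed along
   a stretch of p with O(D) vertices, while subdividing triangles shows that the bypass comes within
   O(log D) of the point, so D is bounded. If g and h are adjacent, a geodesic word for h followed
   by the step to g is still a quasi-geodesic, and two geodesics issuing from the same point that
   are close as sets are close at equal times. Nothing about the shortlex words matters except that
   they are geodesic. *)

theory Submission
  imports Defs
begin

section \<open>The Morse lemma for thin spaces\<close>

lemma square_le_two_power: "(k::nat) * k \<le> 2 * 2 ^ k"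
proof (induction k)
  case (Suc k)
  have "k + 1 \<le> 2 ^ k" by (simp add: Suc_le_eq)
  with Suc show ?case by (simp add: algebra_simps)
qed simp

text \<open>This closes the estimate D = O(log D) of the Morse lemma: there \<open>k\<close> counts
  the halvings of a path with O(D) vertices, and a bound on \<open>k\<close> gives one on D. Trading
  \<open>2 ^ k\<close> for the smaller growth of \<open>k * k\<close> yields an explicit
  bound.\<close>

lemma power_le_linear_bounded: "\<exists>k0. \<forall>k::nat. 2 ^ k \<le> a * k + b \<longrightarrow> k \<le> k0"
proof (intro exI allI impI)
  fix k :: nat
  assume "2 ^ k \<le> a * k + b"
  then have *: "k * k \<le> 2 * a * k + 2 * b"
    using square_le_two_power[of k] by (simp add: algebra_simps)
  show "k \<le> 2 * a + 2 * b"
  proof (rule ccontr)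
    assume "\<not> k \<le> 2 * a + 2 * b"
    then have k: "2 * a + 2 * b + 1 \<le> k" by simp
    have "2 * b * 1 \<le> 2 * b * k" using k by (intro mult_le_mono) auto
    then have "2 * a * k + 2 * b < (2 * a + 2 * b + 1) * k" using k by (simp add: algebra_simps)
    also have "\<dots> \<le> k * k" using k by (rule mult_le_mono1)
    finally show False using * by simp
  qed
qed

text \<open>In a discrete geodesic space, a point \<open>w\<close> lies on some geodesic from \<open>x\<close> to \<open>z\<close> iff
  \<open>d x w + d w z = d x z\<close>, so thin triangles can be stated without mentioning paths.\<close>

locale nat_distance =
  fixes X :: "'a set" and d :: "'a \<Rightarrow> 'a \<Rightarrow> nat"
begin

definition interval :: "'a \<Rightarrow> 'a \<Rightarrow> 'a set" where
  "interval x z = {w \<in> X. d x w + d w z = d x z}"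

lemma interval_iff: "w \<in> interval x z \<longleftrightarrow> w \<in> X \<and> d x w + d w z = d x z"
  by (simp add: interval_def)

end

text \<open>\<open>step\<close> is the existence of geodesics, reduced to a point at each integer
  time. \<open>thin\<close> speaks of one side of the triangle; permuting the vertices covers the
  other two.\<close>

locale thin_space = nat_distance X d
  for X :: "'a set" and d :: "'a \<Rightarrow> 'a \<Rightarrow> nat" +
  fixes \<delta> :: nat
  assumes self: "x \<in> X \<Longrightarrow> d x x = 0"
    and sym: "\<lbrakk>x \<in> X; y \<in> X\<rbrakk> \<Longrightarrow> d x y = d y x"
    and tri: "\<lbrakk>x \<in> X; y \<in> X; z \<in> X\<rbrakk> \<Longrightarrow> d x z \<le> d x y + d y z"
    and step: "\<lbrakk>x \<in> X; z \<in> X; n \<le> d x z\<rbrakk> \<Longrightarrow> \<exists>w\<in>interval x z. d x w = n"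
    and thin: "\<lbrakk>x \<in> X; y \<in> X; z \<in> X; w \<in> interval x z\<rbrakk>
      \<Longrightarrow> \<exists>v\<in>interval x y \<union> interval y z. d w v \<le> \<delta>"
begin

section \<open>Intervals in thin spaces\<close>

lemma interval_sym: "\<lbrakk>x \<in> X; z \<in> X\<rbrakk> \<Longrightarrow> interval x z = interval z x"
  by (auto simp: interval_iff sym)

text \<open>The distances between consecutive points among \<open>a\<close>, \<open>y\<close>,
  \<open>w\<close>, \<open>b\<close> add up to \<open>d a b\<close>, so none of the triangle
  inequalities along the way can be strict.\<close>

lemma interval_trans:
  assumes X: "a \<in> X" "b \<in> X" and w: "w \<in> interval a b" and y: "y \<in> interval a w"
  shows "y \<in> interval a b" "w \<in> interval y b"
proof -
  have "w \<in> X" "y \<in> X" using w y by (auto simp: interval_iff)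
  then have "d a b \<le> d a y + d y b" "d y b \<le> d y w + d w b"
    using X by (auto intro: tri)
  then show "y \<in> interval a b" "w \<in> interval y b"
    using w y by (auto simp: interval_iff)
qed

text \<open>Cut the path in the middle: by thinness of the triangle on \<open>p a\<close>,
  \<open>p m\<close>, \<open>p b\<close>, the point \<open>w\<close> moves by at most
  \<open>\<delta>\<close> to the interval over one half. After \<open>k\<close> halvings at most one
  edge is left, of length at most \<open>\<mu>\<close>.\<close>

lemma interval_near_path:
  assumes "\<And>i. \<lbrakk>a \<le> i; i \<le> b\<rbrakk> \<Longrightarrow> p i \<in> X"
    and "\<And>i. \<lbrakk>a \<le> i; i < b\<rbrakk> \<Longrightarrow> d (p i) (p (Suc i)) \<le> \<mu>"
    and "a \<le> b" "b \<le> a + 2 ^ k" "w \<in> interval (p a) (p b)"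
  shows "\<exists>i. a \<le> i \<and> i \<le> b \<and> d w (p i) \<le> \<delta> * k + \<mu>"
  using assms
proof (induction k arbitrary: a b w)
  case 0
  have X: "p a \<in> X" "w \<in> X" using 0 by (auto simp: interval_iff)
  have "d (p a) (p b) \<le> \<mu>"
  proof (cases "a = b")
    case False
    then have "b = Suc a" using 0 by simp
    then show ?thesis using 0(2)[of a] by simp
  qed (use X self in simp)
  then have "d w (p a) \<le> \<mu>" using 0(5) sym[OF X] by (simp add: interval_iff)
  then show ?case using \<open>a \<le> b\<close> by auto
next
  case (Suc k)
  define m where "m = (a + b) div 2"
  have m: "a \<le> m" "m \<le> b" "m \<le> a + 2 ^ k" "b \<le> m + 2 ^ k"
    using Suc.prems(3,4) by (auto simp: m_def)
  have X: "p a \<in> X" "p m \<in> X" "p b \<in> X" "w \<in> X"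
    using Suc.prems(1,3,5) m by (auto simp: interval_iff)
  obtain v where v: "v \<in> interval (p a) (p m) \<union> interval (p m) (p b)" "d w v \<le> \<delta>"
    using thin[OF X(1-3) Suc.prems(5)] by auto
  have "\<exists>i. a \<le> i \<and> i \<le> b \<and> d v (p i) \<le> \<delta> * k + \<mu>"
  proof (cases "v \<in> interval (p a) (p m)")
    case True
    then have "\<exists>i. a \<le> i \<and> i \<le> m \<and> d v (p i) \<le> \<delta> * k + \<mu>"
      using m by (intro Suc.IH Suc.prems(1,2)) auto
    then show ?thesis using m by (meson le_trans)
  next
    case False
    then have "\<exists>i. m \<le> i \<and> i \<le> b \<and> d v (p i) \<le> \<delta> * k + \<mu>"
      using m v by (intro Suc.IH Suc.prems(1,2)) auto
    then show ?thesis using m by (meson le_trans)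
  qed
  then obtain i where i: "a \<le> i" "i \<le> b" "d v (p i) \<le> \<delta> * k + \<mu>" by blast
  have "v \<in> X" "p i \<in> X" using v(1) i Suc.prems(1) by (auto simp: interval_iff)
  then have "d w (p i) \<le> d w v + d v (p i)" using X tri by blast
  then show ?case using i v(2) by (intro exI[of _ i]) auto
qed

section \<open>Quasi-geodesics and the Morse lemma\<close>

definition quasi_geodesic :: "nat \<Rightarrow> nat \<Rightarrow> nat \<Rightarrow> (nat \<Rightarrow> 'a) \<Rightarrow> nat \<Rightarrow> bool" where
  "quasi_geodesic \<mu> l c p n \<longleftrightarrow>
     (\<forall>i\<le>n. p i \<in> X) \<and> (\<forall>i<n. d (p i) (p (Suc i)) \<le> \<mu>) \<and>
     (\<forall>i j. i \<le> j \<and> j \<le> n \<longrightarrow> j \<le> i + l * d (p i) (p j) + c)"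

lemma quasi_geodesicD:
  assumes "quasi_geodesic \<mu> l c p n"
  shows "i \<le> n \<Longrightarrow> p i \<in> X"
    and "i < n \<Longrightarrow> d (p i) (p (Suc i)) \<le> \<mu>"
    and "\<lbrakk>i \<le> j; j \<le> n\<rbrakk> \<Longrightarrow> j \<le> i + l * d (p i) (p j) + c"
  using assms by (auto simp: quasi_geodesic_def)

text \<open>The upper quasi-geodesic inequality, which the definition imposes on single steps
  only.\<close>

lemma quasi_geodesic_dist_le:
  assumes "quasi_geodesic \<mu> l c p n" "i \<le> j" "j \<le> n"
  shows "d (p i) (p j) \<le> \<mu> * (j - i)"
  using assms(2,3)
proof (induction j rule: dec_induct)
  case base
  then show ?case using quasi_geodesicD(1)[OF assms(1)] self by simp
next
  case (step j)
  then have "d (p i) (p (Suc j)) \<le> d (p i) (p j) + d (p j) (p (Suc j))"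
    using quasi_geodesicD(1)[OF assms(1)] by (intro tri) auto
  also have "\<dots> \<le> \<mu> * (j - i) + \<mu>"
    using step quasi_geodesicD(2)[OF assms(1), of j] by (intro add_mono) auto
  finally show ?case using step by (simp add: Suc_diff_le)
qed

text \<open>Let \<open>w\<close> be a point of the interval farthest from the path, at distance
  \<open>D\<close>. In the quadrilateral \<open>y\<close>, \<open>p i\<close>, \<open>p j\<close>,
  \<open>z\<close> two uses of thinness bring \<open>w\<close> within \<open>2 * \<delta>\<close> of
  one of the three sides of the bypass. If it is a leg, \<open>D\<close> is at most
  \<open>2 * \<delta>\<close>; if it is the side between \<open>p i\<close> and \<open>p j\<close>,
  \<open>interval_near_path\<close> applies to a stretch with O(D) vertices.\<close>

lemma interval_near_quasi_geodesic:
  "\<exists>D0. \<forall>p n w. quasi_geodesic \<mu> l c p n \<longrightarrow> w \<in> interval (p 0) (p n) \<longrightarrow>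
     (\<exists>i\<le>n. d w (p i) \<le> D0)"
proof -
  \<comment> \<open>The right-hand side is \<open>2 * (6 * l * D + c)\<close> with \<open>D\<close>
    replaced by its bound \<open>2 * \<delta> + \<delta> * k + \<mu>\<close>.\<close>
  obtain k0 where k0: "\<And>k::nat. 2 ^ k
      \<le> (12 * l * \<delta>) * k + (12 * l * (2 * \<delta> + \<mu>) + 2 * c) \<Longrightarrow> k \<le> k0"
    using power_le_linear_bounded by meson
  define D0 where "D0 = 2 * \<delta> + \<delta> * k0 + \<mu>"
  have "\<exists>i\<le>n. d w0 (p i) \<le> D0"
    if qg: "quasi_geodesic \<mu> l c p n" and w0: "w0 \<in> interval (p 0) (p n)" for p n w0
  proof -
    note pX = quasi_geodesicD(1)[OF qg]
    have ends: "p 0 \<in> X" "p n \<in> X" using pX by auto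
    define far where "far D \<longleftrightarrow> (\<exists>w\<in>interval (p 0) (p n). \<forall>i\<le>n. D \<le> d w (p i))" for D
    have "far 0" using w0 by (auto simp: far_def)
    \<comment> \<open>The endpoint \<open>p n\<close> lies on the path, and no point of the interval
      is farther from it than \<open>p 0\<close>. So a largest \<open>D\<close> exists.\<close>
    moreover have "D \<le> d (p 0) (p n)" if farD: "far D" for D
    proof -
      obtain w where "w \<in> interval (p 0) (p n)" "D \<le> d w (p n)"
        using farD by (auto simp: far_def)
      then show ?thesis by (auto simp: interval_iff)
    qed
    ultimately obtain D where D: "far D" and Dmax: "\<And>D'. far D' \<Longrightarrow> D' \<le> D"
      by (metis GreatestI_nat Greatest_le_nat)
    have close: "\<exists>i\<le>n. d y (p i) \<le> D" if "y \<in> interval (p 0) (p n)" for y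
    proof (rule ccontr)
      assume "\<not> ?thesis"
      then have "\<forall>i\<le>n. Suc D \<le> d y (p i)" by (meson not_less_eq_eq)
      then have "far (Suc D)" using that unfolding far_def by blast
      then show False using Dmax by fastforce
    qed
    obtain w where w: "w \<in> interval (p 0) (p n)" and wD: "\<And>i. i \<le> n \<Longrightarrow> D \<le> d w (p i)"
      using D by (auto simp: far_def)
    have wX: "w \<in> X" using w by (simp add: interval_iff)
    \<comment> \<open>The bypass of \<open>w\<close> leaves the interval at distance \<open>2 * D\<close> from \<open>w\<close>, or at an endpoint if
      that is nearer; either way its legs to the path stay at distance at least \<open>D\<close> from \<open>w\<close>.\<close>
    have side: "\<exists>y\<in>interval a w. d y w \<le> 2 * D \<and>
        (\<exists>i\<le>n. d y (p i) \<le> D \<and> (\<forall>v\<in>interval y (p i). D \<le> d w v))"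
      if a: "a = p h" "h \<le> n" and sub: "interval a w \<subseteq> interval (p 0) (p n)" for a h
    proof -
      have aX: "a \<in> X" using a pX by simp
      show ?thesis
      proof (cases "d a w \<le> 2 * D")
        case True
        have "D \<le> d w v" if "v \<in> interval a (p h)" for v
        proof -
          have "v \<in> X" "d v a = 0" using that a self[OF aX] by (auto simp: interval_iff)
          then have "d w a \<le> d w v" using tri[OF wX, of v a] aX by simp
          then show ?thesis using wD[of h] a by simp
        qed
        moreover have "a \<in> interval a w" using aX self by (simp add: interval_iff)
        ultimately show ?thesis using True a self[OF aX] by force
      next
        case False
        then obtain y where y: "y \<in> interval w a" "d w y = 2 * D"
          using step[of w a "2 * D"] wX aX sym by auto
        have yX: "y \<in> X" using y by (simp add: interval_iff)
        have ya: "y \<in> interval a w" using y interval_sym wX aX by simp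
        then obtain i where i: "i \<le> n" "d y (p i) \<le> D" using close sub by blast
        have "D \<le> d w v" if "v \<in> interval y (p i)" for v
        proof -
          have "v \<in> X" "d y v \<le> D" using that i by (auto simp: interval_iff)
          then show ?thesis using tri[OF wX _ yX, of v] y sym[OF yX, of v] by simp
        qed
        moreover have "d y w \<le> 2 * D" using y sym[OF wX yX] by simp
        ultimately show ?thesis using ya i by blast
      qed
    qed
    obtain y i where y: "y \<in> interval (p 0) w" "d y w \<le> 2 * D" and i: "i \<le> n" "d y (p i) \<le> D"
      and yv: "\<And>v. v \<in> interval y (p i) \<Longrightarrow> D \<le> d w v"
      using side[of "p 0" 0] interval_trans(1)[OF ends w] by blast
    \<comment> \<open>The second half of the bypass is the same claim with the interval read from
      \<open>p n\<close>.\<close>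
    have w': "w \<in> interval (p n) (p 0)" using w interval_sym ends by simp
    obtain z j where z: "z \<in> interval (p n) w" "d z w \<le> 2 * D" and j: "j \<le> n" "d z (p j) \<le> D"
      and zv: "\<And>v. v \<in> interval z (p j) \<Longrightarrow> D \<le> d w v"
      using side[of "p n" n] interval_trans(1)[OF ends(2,1) w'] interval_sym[OF ends] by blast
    have X: "y \<in> X" "z \<in> X" "p i \<in> X" "p j \<in> X" using y z i j pX by (auto simp: interval_iff)
    have "w \<in> interval y (p n)" using interval_trans(2)[OF ends w y(1)] .
    then have "w \<in> interval (p n) y" using interval_sym ends X by simp
    then have "w \<in> interval z y" using interval_trans(2)[OF ends(2) X(1)] z(1) by blast
    then have wyz: "w \<in> interval y z" using interval_sym X by simp
    \<comment> \<open>The route through \<open>y\<close>, \<open>w\<close>, \<open>z\<close> has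
      pieces of length at most \<open>D\<close>, \<open>2 * D\<close>, \<open>2 * D\<close> and
      \<open>D\<close>.\<close>
    have dij: "d (p i) (p j) \<le> 6 * D"
      using tri[OF X(3,1,4)] tri[OF X(1) wX X(4)] tri[OF wX X(2,4)] y z i j sym X wX by simp
    \<comment> \<open>\<open>P k\<close> says that \<open>k\<close> halvings suffice for the stretch
      of path between \<open>p i\<close> and \<open>p j\<close>. Minimality of \<open>k\<close> is
      used at the end: failure of \<open>P (k - 1)\<close> bounds \<open>2 ^ k\<close> from
      above.\<close>
    define P where "P k \<longleftrightarrow> 6 * l * D + c \<le> 2 ^ k" for k
    define k where "k = (LEAST k. P k)"
    have "P (6 * l * D + c)" unfolding P_def using less_exp less_imp_le by blast
    then have Pk: "P k" unfolding k_def by (rule LeastI)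
    have Dk: "D \<le> 2 * \<delta> + \<delta> * k + \<mu>"
    proof -
      obtain v where v: "v \<in> interval y (p i) \<union> interval (p i) z" "d w v \<le> \<delta>"
        using thin[OF X(1,3,2) wyz] by blast
      have vX: "v \<in> X" using v by (auto simp: interval_iff)
      show ?thesis
      proof (cases "v \<in> interval y (p i)")
        case True
        then show ?thesis using yv v(2) by fastforce
      next
        case False
        then obtain u where u: "u \<in> interval (p i) (p j) \<union> interval (p j) z" "d v u \<le> \<delta>"
          using thin[OF X(3,4,2), of v] v(1) by blast
        have uX: "u \<in> X" using u by (auto simp: interval_iff)
        have wu: "d w u \<le> 2 * \<delta>" using tri[OF wX vX uX] v(2) u(2) by simp
        show ?thesis
        proof (cases "u \<in> interval (p i) (p j)")
          case False
          then have "u \<in> interval z (p j)" using u interval_sym X by auto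
          then show ?thesis using zv wu by fastforce
        next
          case True
          \<comment> \<open>Nothing orders \<open>i\<close> and \<open>j\<close>, so the estimate is
            made for ordered indices and used both ways.\<close>
          have near: "\<exists>m\<le>n. d u (p m) \<le> \<delta> * k + \<mu>"
            if ab: "a \<le> b" "b \<le> n" "u \<in> interval (p a) (p b)" "d (p a) (p b) \<le> 6 * D" for a b
          proof -
            have "b \<le> a + l * d (p a) (p b) + c" using quasi_geodesicD(3)[OF qg] ab by blast
            also have "\<dots> \<le> a + l * (6 * D) + c" using ab by simp
            also have "\<dots> \<le> a + 2 ^ k" using Pk by (simp add: P_def algebra_simps)
            finally have "\<exists>m. a \<le> m \<and> m \<le> b \<and> d u (p m) \<le> \<delta> * k + \<mu>"
              using ab quasi_geodesicD(1,2)[OF qg] by (intro interval_near_path) auto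
            then show ?thesis using ab by (meson le_trans)
          qed
          have "\<exists>m\<le>n. d u (p m) \<le> \<delta> * k + \<mu>"
            using near[of i j] near[of j i] True dij i j interval_sym sym X
            by (metis nle_le)
          then obtain m where m: "m \<le> n" "d u (p m) \<le> \<delta> * k + \<mu>" by blast
          have "D \<le> d w (p m)" using wD m by simp
          also have "\<dots> \<le> d w u + d u (p m)" using tri wX uX pX m by simp
          finally show ?thesis using wu m by simp
        qed
      qed
    qed
    have "k \<le> k0"
    proof (cases k)
      case (Suc k')
      then have "\<not> P k'" using not_less_Least[of k' P] by (simp flip: k_def)
      then have "2 ^ k \<le> 2 * (6 * l * D + c)" using Suc by (simp add: P_def)
      also have "\<dots> \<le> 2 * (6 * l * (2 * \<delta> + \<delta> * k + \<mu>) + c)"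
        using Dk by (intro mult_le_mono2 add_le_mono1)
      finally show ?thesis by (intro k0) (simp add: algebra_simps)
    qed simp
    then have "\<delta> * k \<le> \<delta> * k0" by (rule mult_le_mono2)
    then have "D \<le> D0" using Dk unfolding D0_def by linarith
    then show ?thesis using close[OF w0] by (meson le_trans)
  qed
  then show ?thesis by blast
qed

text \<open>A discrete connectedness argument: each point of the interval is near the path before or
  after time \<open>m\<close>. Where this switches, two path points on either side of time
  \<open>m\<close> are close to each other, and the lower quasi-geodesic inequality bounds the time
  between them.\<close>

lemma quasi_geodesic_near_interval:
  "\<exists>R. \<forall>p n m. quasi_geodesic \<mu> l c p n \<longrightarrow> m \<le> n \<longrightarrow>
     (\<exists>w\<in>interval (p 0) (p n). d (p m) w \<le> R)"
proof -
  obtain D0 where D0: "\<And>p n w. \<lbrakk>quasi_geodesic \<mu> l c p n; w \<in> interval (p 0) (p n)\<rbrakk>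
      \<Longrightarrow> \<exists>i\<le>n. d w (p i) \<le> D0"
    using interval_near_quasi_geodesic by meson
  \<comment> \<open>The bracket bounds the time from \<open>j\<close> to \<open>m\<close>, each step
    costs at most \<open>\<mu>\<close>, and the last \<open>D0\<close> leads from \<open>p j\<close>
    back to the interval.\<close>
  define R where "R = \<mu> * (l * (2 * D0 + 1) + c) + D0"
  have "\<exists>w\<in>interval (p 0) (p n). d (p m) w \<le> R"
    if qg: "quasi_geodesic \<mu> l c p n" and m: "m \<le> n" for p n m
  proof -
    note pX = quasi_geodesicD(1)[OF qg]
    have ends: "p 0 \<in> X" "p n \<in> X" using pX by auto
    define A where "A w \<longleftrightarrow> w \<in> interval (p 0) (p n) \<and> (\<exists>j\<le>m. d w (p j) \<le> D0)" for w
    have "p 0 \<in> interval (p 0) (p n)" using ends self by (simp add: interval_iff)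
    then have "A (p 0)" using ends self by (auto simp: A_def intro!: exI[of _ 0])
    moreover have "\<forall>w. A w \<longrightarrow> d (p 0) w < Suc (d (p 0) (p n))"
      by (auto simp: A_def interval_iff)
    ultimately obtain w where Aw: "A w" and wmax: "\<And>v. A v \<Longrightarrow> d (p 0) v \<le> d (p 0) w"
      using ex_has_greatest_nat[of A "p 0" "\<lambda>w. d (p 0) w"] by metis
    obtain j where w: "w \<in> interval (p 0) (p n)" and j: "j \<le> m" "d w (p j) \<le> D0"
      using Aw by (auto simp: A_def)
    have X: "w \<in> X" "p j \<in> X" "p m \<in> X" using w j m pX by (auto simp: interval_iff)
    \<comment> \<open>\<open>w\<close> is the last point of the interval close to the path before time \<open>m\<close>, so the next one is
      close to the path after time \<open>m\<close>, and the path cannot stray far in between.\<close>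
    have "\<exists>j'. m \<le> j' \<and> j' \<le> n \<and> d w (p j') \<le> D0 + 1"
    proof (cases "d w (p n) = 0")
      case True
      then show ?thesis using m by (intro exI[of _ n]) auto
    next
      case False
      then obtain v where v: "v \<in> interval w (p n)" "d w v = 1"
        using step[of w "p n" 1] X ends by auto
      have vX: "v \<in> X" using v by (simp add: interval_iff)
      have "d (p 0) (p n) \<le> d (p 0) v + d v (p n)" "d (p 0) v \<le> d (p 0) w + d w v"
        using tri ends X vX by auto
      then have vi: "v \<in> interval (p 0) (p n)" and dv: "d (p 0) v = d (p 0) w + 1"
        using v w by (auto simp: interval_iff)
      then have "\<not> A v" using wmax by fastforce
      moreover obtain j' where j': "j' \<le> n" "d v (p j') \<le> D0" using D0[OF qg vi] by blast
      ultimately have "m \<le> j'" unfolding A_def using vi by (meson nle_le)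
      moreover have "d w (p j') \<le> D0 + 1" using tri[OF X(1) vX pX[OF j'(1)]] v j' by simp
      ultimately show ?thesis using j' by blast
    qed
    then obtain j' where j': "m \<le> j'" "j' \<le> n" "d w (p j') \<le> D0 + 1" by blast
    have "d (p j) (p j') \<le> 2 * D0 + 1"
      using tri[OF X(2,1), of "p j'"] pX[OF j'(2)] j j' sym X by simp
    then have "j' \<le> j + l * (2 * D0 + 1) + c"
      using quasi_geodesicD(3)[OF qg, of j j'] j j'
      by (smt (verit) add_le_mono1 le_trans mult_le_mono2 nat_add_left_cancel_le)
    then have "m - j \<le> l * (2 * D0 + 1) + c" using j' by simp
    then have "d (p j) (p m) \<le> \<mu> * (l * (2 * D0 + 1) + c)"
      using quasi_geodesic_dist_le[OF qg j(1) m] by (meson le_trans mult_le_mono2)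
    then have "d (p m) w \<le> R"
      using tri[OF X(3,2,1)] j sym X by (simp add: R_def)
    then show ?thesis using w by blast
  qed
  then show ?thesis by blast
qed

text \<open>The interval between the common endpoints mediates: from \<open>p\<close> to the
  interval by one of the two preceding lemmas, from there to \<open>q\<close> by the other.\<close>

theorem quasi_geodesics_close:
  "\<exists>R. \<forall>p q n m i. quasi_geodesic \<mu> l c p n \<and> quasi_geodesic \<mu> l c q m \<and>
     p 0 = q 0 \<and> p n = q m \<and> i \<le> n \<longrightarrow> (\<exists>j\<le>m. d (p i) (q j) \<le> R)"
proof -
  obtain D where D: "\<And>p n w. \<lbrakk>quasi_geodesic \<mu> l c p n; w \<in> interval (p 0) (p n)\<rbrakk>
      \<Longrightarrow> \<exists>i\<le>n. d w (p i) \<le> D"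
    using interval_near_quasi_geodesic by meson
  obtain E where E: "\<And>p n m. \<lbrakk>quasi_geodesic \<mu> l c p n; m \<le> n\<rbrakk>
      \<Longrightarrow> \<exists>w\<in>interval (p 0) (p n). d (p m) w \<le> E"
    using quasi_geodesic_near_interval by meson
  have "\<exists>j\<le>m. d (p i) (q j) \<le> E + D"
    if p: "quasi_geodesic \<mu> l c p n" and q: "quasi_geodesic \<mu> l c q m"
      and ends: "p 0 = q 0" "p n = q m" and i: "i \<le> n" for p q n m i
  proof -
    obtain w where w: "w \<in> interval (p 0) (p n)" "d (p i) w \<le> E" using E[OF p i] by blast
    then obtain j where j: "j \<le> m" "d w (q j) \<le> D" using D[OF q] ends by auto
    have "d (p i) (q j) \<le> d (p i) w + d w (q j)"
      using w i j quasi_geodesicD(1)[OF p] quasi_geodesicD(1)[OF q]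
      by (intro tri) (auto simp: interval_iff)
    then show ?thesis using w j by (intro exI[of _ j]) auto
  qed
  then show ?thesis by blast
qed

end

section \<open>Word metrics\<close>

locale symmetric_generators = group G for G (structure) +
  fixes S :: "'a set"
  assumes generating: "symmetric_generating_set G S"
begin

abbreviation dist :: "'a \<Rightarrow> 'a \<Rightarrow> nat" where "dist \<equiv> word_dist G S"

section \<open>Words and the word distance\<close>

lemma finite_gens: "finite S" and gens_closed: "S \<subseteq> carrier G"
  and gens_inv: "s \<in> S \<Longrightarrow> inv s \<in> S" and generate_gens: "generate G S = carrier G"
  using generating by (auto simp: symmetric_generating_set_def)

lemma word_eval_Nil [simp]: "word_eval G [] = \<one>"
  and word_eval_Cons [simp]: "word_eval G (s # w) = s \<otimes> word_eval G w"
  by (simp_all add: word_eval_def)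

lemma word_eval_closed [simp]: "set w \<subseteq> carrier G \<Longrightarrow> word_eval G w \<in> carrier G"
  by (induction w) auto

lemma word_eval_closed_gens [simp]: "set w \<subseteq> S \<Longrightarrow> word_eval G w \<in> carrier G"
  using gens_closed by simp

lemma word_eval_append:
  "\<lbrakk>set u \<subseteq> carrier G; set v \<subseteq> carrier G\<rbrakk>
     \<Longrightarrow> word_eval G (u @ v) = word_eval G u \<otimes> word_eval G v"
  by (induction u) (auto simp: m_assoc)

lemma word_eval_rev_inv:
  "set w \<subseteq> carrier G \<Longrightarrow> word_eval G (rev (map (m_inv G) w)) = inv (word_eval G w)"
proof (induction w)
  case (Cons s w)
  then have "set (rev (map (m_inv G) w)) \<subseteq> carrier G" by auto
  with Cons show ?case by (simp add: word_eval_append inv_mult_group)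
qed simp

lemma ex_word:
  assumes "g \<in> carrier G"
  shows "\<exists>w. set w \<subseteq> S \<and> word_eval G w = g"
proof -
  have "g \<in> generate G S" using assms generate_gens by simp
  then show ?thesis
  proof induction
    case one
    show ?case by (rule exI[of _ "[]"]) simp
  next
    case (incl h)
    then show ?case using gens_closed by (intro exI[of _ "[h]"]) auto
  next
    case (inv h)
    then show ?case using gens_closed gens_inv by (intro exI[of _ "[inv h]"]) auto
  next
    case (eng h1 h2)
    then obtain u v where "set u \<subseteq> S" "word_eval G u = h1" "set v \<subseteq> S" "word_eval G v = h2"
      by blast
    then show ?case using gens_closed by (intro exI[of _ "u @ v"]) (auto simp: word_eval_append)
  qed
qed

lemma dist_self [simp]: "dist g g = 0"
  by (simp add: word_dist_def)

lemma dist_le_length: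
  assumes "set w \<subseteq> S"
  shows "dist (h \<otimes> word_eval G w) h \<le> length w"
  unfolding word_dist_def using assms by (auto intro: Least_le)

lemma dist_word:
  assumes "g \<in> carrier G" "h \<in> carrier G"
  obtains w where "set w \<subseteq> S" "length w = dist g h" "g = h \<otimes> word_eval G w"
proof (cases "g = h")
  case True
  then show ?thesis using that[of "[]"] assms by simp
next
  case False
  define P where "P n \<longleftrightarrow> (\<exists>w. length w = n \<and> set w \<subseteq> S \<and> g = h \<otimes> word_eval G w)" for n
  obtain w where "set w \<subseteq> S" "word_eval G w = inv h \<otimes> g"
    using ex_word[of "inv h \<otimes> g"] assms by auto
  then have "P (length w)" using assms by (auto simp: P_def m_assoc[symmetric])
  then have "P (LEAST n. P n)" by (rule LeastI)
  then have "P (dist g h)" using False by (simp add: word_dist_def P_def)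
  then show ?thesis using that by (auto simp: P_def)
qed

lemma dist_sym_le:
  assumes g: "g \<in> carrier G" "h \<in> carrier G"
  shows "dist h g \<le> dist g h"
proof -
  obtain w where w: "set w \<subseteq> S" "length w = dist g h" "g = h \<otimes> word_eval G w"
    using dist_word[OF g] .
  then have "h = g \<otimes> inv (word_eval G w)" using g by (simp add: m_assoc)
  also have "inv (word_eval G w) = word_eval G (rev (map (m_inv G) w))"
    using w gens_closed by (simp add: word_eval_rev_inv)
  finally have "h = g \<otimes> word_eval G (rev (map (m_inv G) w))" .
  then show ?thesis
    using dist_le_length[of "rev (map (m_inv G) w)" g] w gens_inv by (auto simp: subset_iff)
qed

lemma dist_sym: "\<lbrakk>g \<in> carrier G; h \<in> carrier G\<rbrakk> \<Longrightarrow> dist g h = dist h g"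
  by (simp add: dist_sym_le le_antisym)

lemma dist_tri:
  assumes x: "x \<in> carrier G" "y \<in> carrier G" "z \<in> carrier G"
  shows "dist x z \<le> dist x y + dist y z"
proof -
  obtain u where u: "set u \<subseteq> S" "length u = dist x y" "x = y \<otimes> word_eval G u"
    using dist_word[OF x(1,2)] .
  obtain v where v: "set v \<subseteq> S" "length v = dist y z" "y = z \<otimes> word_eval G v"
    using dist_word[OF x(2,3)] .
  have "word_eval G (v @ u) = word_eval G v \<otimes> word_eval G u"
    using u v gens_closed by (intro word_eval_append) auto
  then have "x = z \<otimes> word_eval G (v @ u)" using u v x by (simp add: m_assoc)
  then show ?thesis using dist_le_length[of "v @ u" z] u v by simp
qed

lemma dist_subword_le:
  assumes "x \<in> carrier G" "set w \<subseteq> S" "i \<le> j"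
  shows "dist (x \<otimes> word_eval G (take j w)) (x \<otimes> word_eval G (take i w)) \<le> j - i"
proof -
  define u where "u = take (j - i) (drop i w)"
  have "take j w = take i w @ u"
    using assms(3) by (simp add: u_def take_add[symmetric])
  moreover have sub: "set (take i w) \<subseteq> S" "set u \<subseteq> S"
    using assms(2) set_take_subset set_drop_subset unfolding u_def by fast+
  moreover have "set (take i w) \<subseteq> carrier G" "set u \<subseteq> carrier G"
    using sub gens_closed by auto
  ultimately have "x \<otimes> word_eval G (take j w) = x \<otimes> word_eval G (take i w) \<otimes> word_eval G u"
    using assms(1) by (simp add: word_eval_append m_assoc)
  then have "dist (x \<otimes> word_eval G (take j w)) (x \<otimes> word_eval G (take i w)) \<le> length u"
    using dist_le_length[OF sub(2)] by simp
  then show ?thesis by (simp add: u_def)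
qed

lemma set_take_gens: "set w \<subseteq> S \<Longrightarrow> set (take i w) \<subseteq> S"
  using set_take_subset by fast

text \<open>Cutting at \<open>i\<close> and \<open>j\<close> gives three pieces whose lengths bound
  the distances between their ends. The lengths add up to the distance of the extremes, so no piece
  can be shortened.\<close>

lemma dist_subword:
  assumes x: "x \<in> carrier G" and w: "set w \<subseteq> S" "length w = dist (x \<otimes> word_eval G w) x"
    and ij: "i \<le> j" "j \<le> length w"
  shows "dist (x \<otimes> word_eval G (take j w)) (x \<otimes> word_eval G (take i w)) = j - i"
proof -
  define p where "p i = x \<otimes> word_eval G (take i w)" for i
  have p: "p i \<in> carrier G" for i using x w by (simp add: p_def set_take_gens)
  have "length w = dist (p (length w)) (p 0)" using x w(2) by (simp add: p_def)
  then have "length w \<le> dist (p (length w)) (p j) + dist (p j) (p i) + dist (p i) (p 0)"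
    using dist_tri[OF p p p, of "length w" 0 j] dist_tri[OF p p p, of j 0 i] by linarith
  moreover have le: "dist (p j) (p i) \<le> j - i" if "i \<le> j" for i j
    unfolding p_def using x w(1) that by (rule dist_subword_le)
  ultimately have "dist (p j) (p i) = j - i"
    using le[of j "length w"] le[of i j] le[of 0 i] ij by linarith
  then show ?thesis by (simp add: p_def)
qed

section \<open>Intervals as unions of geodesic segments\<close>

sublocale nat_distance "carrier G" dist .

text \<open>Shortest words from \<open>x\<close> to \<open>y\<close> and from \<open>y\<close> to
  \<open>z\<close> concatenate to a shortest word. Together with
  \<open>geodesic_segment_subset\<close> this turns the Rips condition into one on
  intervals.\<close>

lemma geodesic_segment_through:
  assumes x: "x \<in> carrier G" "z \<in> carrier G" and y: "y \<in> interval x z"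
  shows "\<exists>p. geodesic_segment G S x z p \<and> y \<in> set p"
proof -
  have yG: "y \<in> carrier G" using y by (simp add: interval_iff)
  obtain u where u: "set u \<subseteq> S" "length u = dist y x" "y = x \<otimes> word_eval G u"
    using dist_word[OF yG x(1)] .
  obtain v where v: "set v \<subseteq> S" "length v = dist z y" "z = y \<otimes> word_eval G v"
    using dist_word[OF x(2) yG] .
  define w where "w = u @ v"
  define p where "p i = x \<otimes> word_eval G (take i w)" for i
  have wS: "set w \<subseteq> S" using u v by (simp add: w_def)
  have p: "p i \<in> carrier G" for i using x wS by (simp add: p_def set_take_gens)
  have "word_eval G w = word_eval G u \<otimes> word_eval G v"
    unfolding w_def using u v gens_closed by (intro word_eval_append) auto
  then have z: "z = x \<otimes> word_eval G w" using u v x by (simp add: m_assoc)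
  have L: "length w = dist x z" using u v y x yG by (simp add: w_def interval_iff dist_sym)
  have "length w = dist (x \<otimes> word_eval G w) x" using L z x dist_sym by simp
  then have "dist (p (Suc i)) (p i) = 1" if "i < length w" for i
    using dist_subword[OF x(1) wS _, of i "Suc i"] that by (simp add: p_def)
  then have d1: "dist (p i) (p (Suc i)) = 1" if "i < length w" for i
    using that dist_sym[OF p p] by simp
  have "geodesic_segment G S x z (map p [0..<Suc (length w)])"
    unfolding geodesic_segment_def using d1 z L x p
    by (auto simp: nth_append p_def simp del: upt_Suc)
  moreover have "p (length u) = y" using u by (simp add: p_def w_def)
  then have "y \<in> set (map p [0..<Suc (length w)])"
    by (auto simp: w_def image_iff simp del: upt_Suc intro!: bexI[of _ "length u"])
  ultimately show ?thesis by blast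
qed

lemma geodesic_segment_subset:
  assumes p: "geodesic_segment G S x z p" and y: "y \<in> set p"
  shows "y \<in> interval x z"
proof -
  define n where "n = dist x z"
  have pG: "set p \<subseteq> carrier G" "length p = n + 1" "p ! 0 = x" "p ! n = z"
    "\<And>i. i < n \<Longrightarrow> dist (p ! i) (p ! Suc i) = 1"
    using p by (auto simp: geodesic_segment_def n_def)
  have pn: "p ! i \<in> carrier G" if "i \<le> n" for i
    using pG that by (metis nth_mem le_imp_less_Suc Suc_eq_plus1 subsetD)
  have le: "dist (p ! i) (p ! j) \<le> j - i" if "i \<le> j" "j \<le> n" for i j
    using that
  proof (induction j rule: dec_induct)
    case (step j)
    have "dist (p ! i) (p ! Suc j) \<le> dist (p ! i) (p ! j) + dist (p ! j) (p ! Suc j)"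
      using step by (intro dist_tri pn) auto
    then show ?case using step pG(5)[of j] by simp
  qed simp
  obtain k where k: "k \<le> n" "y = p ! k" using y pG by (auto simp: in_set_conv_nth less_Suc_eq_le)
  have "dist x y \<le> k" "dist y z \<le> n - k" using le[of 0 k] le[of k n] k pG by auto
  moreover have "n \<le> dist x y + dist y z"
    unfolding n_def using pn[of 0] pn[of n] pn[of k] k pG by (intro dist_tri) auto
  ultimately have "dist x y + dist y z = n" using k by simp
  then show ?thesis using pn k by (simp add: interval_iff n_def)
qed

lemma interval_step:
  assumes x: "x \<in> carrier G" "z \<in> carrier G" "n \<le> dist x z"
  shows "\<exists>y\<in>interval x z. dist x y = n"
proof -
  obtain w where w: "set w \<subseteq> S" "length w = dist x z" "x = z \<otimes> word_eval G w"
    using dist_word[OF x(1,2)] .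
  \<comment> \<open>The word leads from \<open>z\<close> to \<open>x\<close>, so distance
    \<open>n\<close> from \<open>x\<close> means omitting the last \<open>n\<close> letters.\<close>
  define y where "y = z \<otimes> word_eval G (take (length w - n) w)"
  have y: "y \<in> carrier G" using x w by (simp add: y_def set_take_gens)
  have L: "length w = dist (z \<otimes> word_eval G w) z" using w by simp
  have "dist x y = n" "dist y z = length w - n"
    using dist_subword[OF x(2) w(1) L, of "length w - n" "length w"]
      dist_subword[OF x(2) w(1) L, of 0 "length w - n"] w x
    by (simp_all add: y_def)
  then show ?thesis using y x(3) w by (intro bexI[of _ y]) (auto simp: interval_iff)
qed

lemma thin_space_of_hyperbolic:
  assumes "rips_hyperbolic_wrt G S"
  shows "\<exists>\<delta>. thin_space (carrier G) dist \<delta>"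
proof -
  obtain K :: real where "K \<ge> 0" and K: "\<And>x y z p1 p2 p3 p.
      \<lbrakk>x \<in> carrier G; y \<in> carrier G; z \<in> carrier G; geodesic_segment G S x y p1;
       geodesic_segment G S y z p2; geodesic_segment G S x z p3; p \<in> set p3\<rbrakk>
      \<Longrightarrow> within_dist G S K p (set p1 \<union> set p2)"
    using assms unfolding rips_hyperbolic_wrt_def by blast
  \<comment> \<open>Distances are natural numbers, so the real constant can be rounded down.\<close>
  have "thin_space (carrier G) dist (nat \<lfloor>K\<rfloor>)"
  proof
    fix x y z w
    assume x: "x \<in> carrier G" "y \<in> carrier G" "z \<in> carrier G" and w: "w \<in> interval x z"
    \<comment> \<open>Endpoints lie in the intervals; this serves only to obtain some geodesic
      segment for each of the other two sides.\<close>
    have "x \<in> interval x y" "y \<in> interval y z" using x by (auto simp: interval_iff)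
    then obtain p1 p2 p3 where p: "geodesic_segment G S x y p1" "geodesic_segment G S y z p2"
      "geodesic_segment G S x z p3" "w \<in> set p3"
      using geodesic_segment_through x w by meson
    obtain v where v: "v \<in> set p1 \<union> set p2" "real (dist w v) \<le> K"
      using K[OF x p] by (auto simp: within_dist_def)
    moreover have "v \<in> interval x y \<union> interval y z"
      using v p geodesic_segment_subset by blast
    ultimately show "\<exists>v\<in>interval x y \<union> interval y z. dist w v \<le> nat \<lfloor>K\<rfloor>"
      by (intro bexI[of _ v]) linarith+
  qed (use dist_self dist_sym dist_tri interval_step in auto)
  then show ?thesis by blast
qed

text \<open>Two cancelling neighbours would make prefixes differing by two letters evaluate equally.
  Hence restricting the shortlex minimum to reduced words does not exclude the geodesic
  ones.\<close>

lemma shortest_word_reduced: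
  assumes w: "set w \<subseteq> S" "length w = dist (word_eval G w) \<one>"
  shows "w \<in> reduced_words G S"
proof -
  have "w ! (i + 1) \<noteq> inv (w ! i)" if i: "i + 1 < length w" for i
  proof
    assume inv: "w ! (i + 1) = inv (w ! i)"
    have S: "set (take i w) \<subseteq> S" "w ! i \<in> S"
      using w(1) i nth_mem[of i w] by (auto dest: in_set_takeD)
    have "take (i + 2) w = take i w @ [w ! i, w ! (i + 1)]"
      using i by (simp add: take_Suc_conv_app_nth)
    moreover have "set [w ! i, w ! (i + 1)] \<subseteq> carrier G" "set (take i w) \<subseteq> carrier G"
      using S inv gens_closed by auto
    ultimately have "word_eval G (take (i + 2) w) = word_eval G (take i w)"
      using inv by (simp add: word_eval_append r_inv)
    then have "dist (\<one> \<otimes> word_eval G (take (i + 2) w)) (\<one> \<otimes> word_eval G (take i w)) = 0"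
      by simp
    moreover have "dist (\<one> \<otimes> word_eval G (take (i + 2) w)) (\<one> \<otimes> word_eval G (take i w)) = 2"
      using dist_subword[of \<one> w i "i + 2"] w i by simp
    ultimately show False by simp
  qed
  then show ?thesis using w(1) by (simp add: reduced_words_def)
qed

end

section \<open>Shortlex words and fellow travelling\<close>

lemma lexord_total_on:
  assumes "total_on S r" "length u = length v" "set u \<subseteq> S" "set v \<subseteq> S"
  shows "u = v \<or> (u, v) \<in> lexord (r - Id) \<or> (v, u) \<in> lexord (r - Id)"
  using assms(2-4)
proof (induction u v rule: list_induct2)
  case (Cons x xs y ys)
  then show ?case using assms(1) by (auto simp: total_on_def)
qed simp

context symmetric_generators
begin

lemma shortlex_word_geodesic:
  assumes r: "linear_order_on S r" and g: "g \<in> carrier G"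
  defines "w \<equiv> shortlex_word G S r g"
  shows "set w \<subseteq> S" "word_eval G w = g" "length w = dist g \<one>"
proof -
  have trans: "trans r" and antisym: "antisym r" and total: "total_on S r" and sub: "r \<subseteq> S \<times> S"
    using r by (auto simp: linear_order_on_def partial_order_on_def preorder_on_def refl_on_def)
  \<comment> \<open>A strict order on a finite alphabet is well-founded, and so is the
    length-lexicographic order it induces; this provides the minimal word \<open>m\<close>.\<close>
  have "trans (r - Id)" using trans antisym by (rule trans_diff_Id)
  then have "acyclic (r - Id)" by (simp add: acyclic_def)
  moreover have "finite r" using sub finite_gens by (meson finite_SigmaI finite_subset)
  ultimately have "wf (r - Id)" using finite_acyclic_wf by blast
  then have wf: "wf (lenlex (r - Id))" by (rule wf_lenlex)
  define W where "W = {w \<in> reduced_words G S. word_eval G w = g}"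
  have WS: "set v \<subseteq> S" if "v \<in> W" for v using that by (simp add: W_def reduced_words_def)
  obtain w0 where w0: "set w0 \<subseteq> S" "length w0 = dist g \<one>" "g = \<one> \<otimes> word_eval G w0"
    using dist_word[OF g one_closed] .
  then have "w0 \<in> W" using shortest_word_reduced by (auto simp: W_def)
  then obtain m where m: "m \<in> W" and min: "\<And>v. (v, m) \<in> lenlex (r - Id) \<Longrightarrow> v \<notin> W"
    using wfE_min[OF wf] by metis
  have le: "shortlex_le r m v" if "v \<in> W" for v
  proof -
    have not_less: "(v, m) \<notin> lenlex (r - Id)" using min that by blast
    show ?thesis
    proof (cases "length m = length v")
      case True
      then have "(v, m) \<notin> lexord (r - Id)" using not_less by (simp add: lenlex_conv lexord_lex)
      then show ?thesis
        using lexord_total_on[OF total True WS[OF m] WS[OF that]] True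
        unfolding shortlex_le_def lex_le_def by blast
    next
      case False
      then show ?thesis using not_less by (simp add: lenlex_conv shortlex_le_def)
    qed
  qed
  \<comment> \<open>Asymmetry makes the minimum unique, so that the definite description denotes
    \<open>m\<close>.\<close>
  have "asym (r - Id)" using antisymD[OF antisym] by (intro asymI) blast
  then have unique: "v = m" if "v \<in> W" "\<And>u. u \<in> W \<Longrightarrow> shortlex_le r v u" for v
    using that(2)[OF m] le[OF that(1)]
    by (auto simp: shortlex_le_def lex_le_def dest: lexord_asymmetric)
  have "w = (THE v. v \<in> W \<and> (\<forall>u\<in>W. shortlex_le r v u))"
    unfolding w_def shortlex_word_def W_def by (rule arg_cong[where f = The]) (rule ext, blast)
  also have "\<dots> = m" using m le unique by (intro the_equality) blast+
  finally have "w = m" .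
  moreover have "length m \<le> length w0"
    using le[OF \<open>w0 \<in> W\<close>] unfolding shortlex_le_def by linarith
  moreover have "dist g \<one> \<le> length m"
    using dist_le_length[OF WS[OF m], of \<one>] m WS[OF m] by (simp add: W_def)
  ultimately show "set w \<subseteq> S" "word_eval G w = g" "length w = dist g \<one>"
    using m WS[OF m] w0(2) by (simp_all add: W_def)
qed

text \<open>Replace each letter from \<open>T\<close> by a fixed word over \<open>S\<close>. Used in
  both directions, this makes geodesics for one generating set quasi-geodesics for the
  other.\<close>

lemma word_dist_Lipschitz:
  assumes "symmetric_generating_set G T"
  shows "\<exists>l. \<forall>g\<in>carrier G. \<forall>h\<in>carrier G. dist g h \<le> l * word_dist G T g h"
proof -
  interpret T: symmetric_generators G T by unfold_locales (rule assms)
  have "\<forall>t\<in>T. \<exists>w. set w \<subseteq> S \<and> word_eval G w = t" using ex_word T.gens_closed by blast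
  then obtain f where f: "\<And>t. t \<in> T \<Longrightarrow> set (f t) \<subseteq> S \<and> word_eval G (f t) = t" by metis
  \<comment> \<open>A common bound for the lengths \<open>length (f t)\<close> is wanted; unlike a
    maximum, the sum also makes sense for empty \<open>T\<close>.\<close>
  define l where "l = (\<Sum>t\<in>T. length (f t))"
  have l: "length (f t) \<le> l" if "t \<in> T" for t
    unfolding l_def using T.finite_gens that by (intro member_le_sum) auto
  have "\<exists>u. set u \<subseteq> S \<and> word_eval G u = word_eval G w \<and> length u \<le> l * length w"
    if "set w \<subseteq> T" for w
    using that
  proof (induction w)
    case (Cons t w)
    then obtain u where "set u \<subseteq> S" "word_eval G u = word_eval G w" "length u \<le> l * length w"
      by auto
    moreover have "set (f t) \<subseteq> S" "word_eval G (f t) = t" "length (f t) \<le> l"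
      using Cons f l by auto
    ultimately show ?case
      using gens_closed by (intro exI[of _ "f t @ u"]) (auto simp: word_eval_append)
  qed (auto intro: exI[of _ "[]"])
  note translate = this
  have "dist g h \<le> l * word_dist G T g h" if gh: "g \<in> carrier G" "h \<in> carrier G" for g h
  proof -
    obtain w where w: "set w \<subseteq> T" "length w = word_dist G T g h" "g = h \<otimes> word_eval G w"
      using T.dist_word[OF gh] .
    obtain u where "set u \<subseteq> S" "word_eval G u = word_eval G w" "length u \<le> l * length w"
      using translate[OF w(1)] by blast
    then show ?thesis using dist_le_length[of u h] w by simp
  qed
  then show ?thesis by blast
qed

theorem geodesics_fellow_travel:
  assumes "hyperbolic_group G"
  shows "\<exists>K. \<forall>u v i. set u \<subseteq> S \<and> length u = dist (word_eval G u) \<one> \<and>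
      set v \<subseteq> S \<and> length v = dist (word_eval G v) \<one> \<and>
      dist (word_eval G u) (word_eval G v) \<le> 1 \<and> i \<le> length u \<and> i \<le> length v \<longrightarrow>
      dist (word_eval G (take i u)) (word_eval G (take i v)) \<le> K"
proof -
  obtain T where T: "symmetric_generating_set G T" "rips_hyperbolic_wrt G T"
    using assms by (auto simp: hyperbolic_group_def)
  interpret T: symmetric_generators G T by unfold_locales (rule T(1))
  obtain \<delta> where "thin_space (carrier G) T.dist \<delta>" using T.thin_space_of_hyperbolic T(2) by blast
  then interpret thin: thin_space "carrier G" T.dist \<delta> .
  obtain l where l: "\<And>g h. \<lbrakk>g \<in> carrier G; h \<in> carrier G\<rbrakk> \<Longrightarrow> dist g h \<le> l * T.dist g h"
    using word_dist_Lipschitz[OF T(1)] by blast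
  obtain \<mu> where \<mu>: "\<And>g h. \<lbrakk>g \<in> carrier G; h \<in> carrier G\<rbrakk> \<Longrightarrow> T.dist g h \<le> \<mu> * dist g h"
    using T.word_dist_Lipschitz[OF generating] by blast
  \<comment> \<open>The additive constant 2 is for the prolonged path \<open>q'\<close> below: one
    for its extra index, one for the distance between the ends of \<open>q\<close> and
    \<open>q'\<close>.\<close>
  obtain R where R: "\<And>p q n m i. \<lbrakk>thin.quasi_geodesic \<mu> l 2 p n; thin.quasi_geodesic \<mu> l 2 q m;
      p 0 = q 0; p n = q m; i \<le> n\<rbrakk> \<Longrightarrow> \<exists>j\<le>m. T.dist (p i) (q j) \<le> R"
    using thin.quasi_geodesics_close by meson
  have "dist (word_eval G (take i u)) (word_eval G (take i v)) \<le> 2 * (l * R + 1)"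
    if u: "set u \<subseteq> S" "length u = dist (word_eval G u) \<one>"
      and v: "set v \<subseteq> S" "length v = dist (word_eval G v) \<one>"
      and uv: "dist (word_eval G u) (word_eval G v) \<le> 1"
      and i: "i \<le> length u" "i \<le> length v" for u v i
  proof -
    define p where "p i = word_eval G (take i u)" for i
    define q where "q i = word_eval G (take i v)" for i
    \<comment> \<open>One extra step takes the path of \<open>v\<close> to the endpoint of the path
      of \<open>u\<close>, as the Morse lemma asks for common endpoints.\<close>
    define q' where "q' i = (if i \<le> length v then q i else word_eval G u)" for i
    have pG: "p i \<in> carrier G" and qG: "q i \<in> carrier G" for i
      using u v by (simp_all add: p_def q_def set_take_gens)
    then have q'G: "q' i \<in> carrier G" for i using u by (simp add: q'_def)
    have pd: "dist (p a) (p b) = b - a" if "a \<le> b" "b \<le> length u" for a b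
      using dist_subword[of \<one> u a b] u that dist_sym[OF pG pG] set_take_gens by (simp add: p_def)
    have qd: "dist (q a) (q b) = b - a" if "a \<le> b" "b \<le> length v" for a b
      using dist_subword[of \<one> v a b] v that dist_sym[OF qG qG] set_take_gens by (simp add: q_def)
    have qu: "dist (q (length v)) (word_eval G u) \<le> 1"
      using uv u v dist_sym by (simp add: q_def)
    have "thin.quasi_geodesic \<mu> l 2 p (length u)"
      unfolding thin.quasi_geodesic_def
    proof (intro conjI allI impI)
      fix a assume "a < length u"
      then show "T.dist (p a) (p (Suc a)) \<le> \<mu>"
        using \<mu>[OF pG pG, of a "Suc a"] pd[of a "Suc a"] by simp
    next
      fix a b assume "a \<le> b \<and> b \<le> length u"
      then show "b \<le> a + l * T.dist (p a) (p b) + 2"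
        using l[OF pG pG, of a b] pd[of a b] by simp
    qed (rule pG)
    moreover have "thin.quasi_geodesic \<mu> l 2 q' (Suc (length v))"
      unfolding thin.quasi_geodesic_def
    proof (intro conjI allI impI)
      fix a assume a: "a < Suc (length v)"
      have "dist (q' a) (q' (Suc a)) \<le> 1"
        using a qd[of a "Suc a"] qu by (cases "a = length v") (auto simp: q'_def)
      then have "\<mu> * dist (q' a) (q' (Suc a)) \<le> \<mu> * 1" by (rule mult_le_mono2)
      then show "T.dist (q' a) (q' (Suc a)) \<le> \<mu>"
        using \<mu>[OF q'G q'G, of a "Suc a"] by linarith
    next
      fix a b assume ab: "a \<le> b \<and> b \<le> Suc (length v)"
      have "b - a \<le> dist (q' a) (q' b) + 2"
      proof (cases "b \<le> length v \<or> a = b")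
        case True
        then show ?thesis using ab qd[of a b] by (auto simp: q'_def)
      next
        case False
        then have b: "b = Suc (length v)" "a \<le> length v" using ab by auto
        have "length v - a \<le> dist (q a) (word_eval G u) + dist (word_eval G u) (q (length v))"
          using qd[of a "length v"] b dist_tri[OF qG _ qG, of "word_eval G u" a "length v"] u by simp
        also have "dist (word_eval G u) (q (length v)) \<le> 1" using qu dist_sym qG u by simp
        finally show ?thesis using b by (simp add: q'_def)
      qed
      then show "b \<le> a + l * T.dist (q' a) (q' b) + 2"
        using l[OF q'G q'G, of a b] by simp
    qed (rule q'G)
    moreover have "p 0 = q' 0" "p (length u) = q' (Suc (length v))"
      by (simp_all add: p_def q_def q'_def)
    ultimately obtain j where j: "j \<le> Suc (length v)" "T.dist (p i) (q' j) \<le> R"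
      using R i by blast
    have pq': "dist (p i) (q' j) \<le> l * R"
      using l[OF pG q'G, of i j] j(2) by (meson le_trans mult_le_mono2)
    \<comment> \<open>If the nearby point is the added one, the last vertex of \<open>q\<close>
      replaces it at cost 1.\<close>
    have "\<exists>k\<le>length v. dist (p i) (q k) \<le> l * R + 1"
    proof (cases "j \<le> length v")
      case True
      then show ?thesis using pq' by (auto simp: q'_def)
    next
      case False
      then have "dist (p i) (q (length v)) \<le> l * R + 1"
        using pq' qu dist_tri[OF pG _ qG, of "word_eval G u" i "length v"] u
          dist_sym[OF qG, of "word_eval G u" "length v"]
        by (simp add: q'_def)
      then show ?thesis by blast
    qed
    then obtain k where k: "k \<le> length v" "dist (p i) (q k) \<le> l * R + 1" by blast
    \<comment> \<open>On both paths the index is the distance from the identity, so \<open>i\<close>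
      and \<open>k\<close> differ by at most \<open>dist (p i) (q k)\<close>. Moving along
      \<open>q\<close> from \<open>q k\<close> to \<open>q i\<close> at most doubles the
      bound.\<close>
    have "p 0 = q 0" by (simp add: p_def q_def)
    then have "i \<le> k + dist (p i) (q k)" "k \<le> i + dist (p i) (q k)"
      using dist_tri[OF pG qG pG, of 0 i k] dist_tri[OF qG pG qG, of 0 k i] pd[of 0 i] qd[of 0 k]
        i k dist_sym[OF pG qG, of i k] by auto
    moreover have "dist (q k) (q i) = (if i \<le> k then k - i else i - k)"
      using qd[of i k] qd[of k i] dist_sym[OF qG qG, of i k] i k by simp
    ultimately have "dist (p i) (q i) \<le> 2 * (l * R + 1)"
      using dist_tri[OF pG qG qG, of i i k] k by (simp split: if_splits)
    then show ?thesis by (simp add: p_def q_def)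
  qed
  then show ?thesis by blast
qed

end

section \<open>The listed generators with their inverses\<close>

lemma set_with_inverses: "set (with_inverses G as) = set as \<union> m_inv G ` set as"
  by (auto simp: with_inverses_def)

lemma (in group) symmetric_generating_set_with_inverses:
  assumes "set as \<subseteq> carrier G" "generate G (set as) = carrier G"
  shows "symmetric_generating_set G (set (with_inverses G as))"
proof -
  have sub: "set (with_inverses G as) \<subseteq> carrier G" using assms by (auto simp: set_with_inverses)
  have "carrier G \<subseteq> generate G (set (with_inverses G as))"
    unfolding assms(2)[symmetric] by (rule mono_generate) (simp add: set_with_inverses)
  moreover have "inv s \<in> set (with_inverses G as)" if "s \<in> set (with_inverses G as)" for s
    using that assms by (auto simp: set_with_inverses subset_iff)
  ultimately show ?thesis
    using sub generate_incl[OF sub] by (auto simp: symmetric_generating_set_def)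
qed

theorem mainTheorem6:
  fixes G :: "('a, 'b) monoid_scheme" and as :: "'a list"
  assumes "group G"
    and "set as \<subseteq> carrier G"
    and "generate G (set as) = carrier G"
    and "hyperbolic_group G"
  shows "shortlex_combable G (set (with_inverses G as)) (listing_order (with_inverses G as))"
proof -
  define S where "S = set (with_inverses G as)"
  define r where "r = listing_order (with_inverses G as)"
  interpret group G by fact
  interpret symmetric_generators G S
    using symmetric_generating_set_with_inverses assms by unfold_locales (simp add: S_def)
  have r: "linear_order_on S r" unfolding S_def r_def by (rule linear_order_listing_order)
  obtain K where K: "\<And>u v i. \<lbrakk>set u \<subseteq> S; length u = dist (word_eval G u) \<one>\<^bsub>G\<^esub>;
      set v \<subseteq> S; length v = dist (word_eval G v) \<one>\<^bsub>G\<^esub>; dist (word_eval G u) (word_eval G v) \<le> 1;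
      i \<le> length u; i \<le> length v\<rbrakk> \<Longrightarrow> dist (word_eval G (take i u)) (word_eval G (take i v)) \<le> K"
    using geodesics_fellow_travel[OF assms(4)] by meson
  have "shortlex_combable G S r"
    unfolding shortlex_combable_def
  \<comment> \<open>Combability asks for a constant of at least 1, which \<open>K + 1\<close>
    guarantees.\<close>
  proof (intro exI[of _ "real (K + 1)"] conjI ballI allI impI)
    fix g h i
    assume gh: "g \<in> carrier G" "h \<in> carrier G" "dist g h = 1"
      and i: "i \<le> min (dist g \<one>\<^bsub>G\<^esub>) (dist h \<one>\<^bsub>G\<^esub>)"
    have "dist (word_eval G (take i (shortlex_word G S r g)))
        (word_eval G (take i (shortlex_word G S r h))) \<le> K"
      using gh i shortlex_word_geodesic[OF r gh(1)] shortlex_word_geodesic[OF r gh(2)]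
      by (intro K) auto
    then show "real (dist (word_eval G (take i (shortlex_word G S r g)))
        (word_eval G (take i (shortlex_word G S r h)))) \<le> real (K + 1)" by simp
  qed simp
  then show ?thesis by (simp add: S_def r_def)
qed

end
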